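(* For every integer $n\geq 2$, the Bernoulli-Fibonacci numbers satisfy $$\sum_{j=0}^{n-1} {n \brack j}_F\, b_j^F = 0.$$
   Context: Let $F_n$ be the Fibonacci numbers ($F_0=0$, $F_1=F_2=1$, $F_{n+1}=F_n+F_{n-1}$). The Fibonacci factorial is $F_n! = F_1F_2\cdots F_n$ for $n\ge 1$, with $F_0! = 1$. The Fibonomial coefficients are ${n \brack k}_F = \frac{F_n!}{F_{n-k}!\,F_k!}$ for integers $n\geq k\geq 0$. The Golden exponential function is $e_F^x = \sum_{n=0}^\infty \frac{x^n}{F_n!}$ (written $e_F^{zx}$ when evaluated at $zx$). The Bernoulli-Fibonacci polynomials $B_n^F(x)$, $n\geq 0$, are defined by the generating function (power series in $z$) $$\frac{z\, e_F^{zx}}{e_F^{z}-1} = \sum_{n=0}^\infty B_n^F(x)\frac{z^n}{F_n!}.$$ The Bernoulli-Fibonacci numbers are $b_n^F = B_n^F(0)$; equivalently $\frac{z}{e_F^z-1} = \sum_{n=0}^\infty b_n^F \frac{z^n}{F_n!}$. *)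

theory Defs
  imports "HOL-Number_Theory.Fib" "HOL-Computational_Algebra.Formal_Power_Series"
begin

definition fib_fact :: "nat \<Rightarrow> nat" where
  "fib_fact n = (\<Prod>k=1..n. fib k)"

text \<open>Only meaningful for \<open>k \<le> n\<close>; for \<open>k > n\<close> the truncated subtraction gives a junk value.\<close>
definition fibonomial :: "nat \<Rightarrow> nat \<Rightarrow> real" where
  "fibonomial n k = real (fib_fact n) / (real (fib_fact (n - k)) * real (fib_fact k))"

text \<open>The golden exponential evaluated at \<open>z * x\<close>, as a formal power series in \<open>z\<close>.\<close>
definition golden_exp :: "real \<Rightarrow> real fps" where
  "golden_exp x = Abs_fps (\<lambda>n. x ^ n / real (fib_fact n))"

text \<open>The denominator has subdegree 1, so this quotient of formal power series is exact:
  see \<open>bernoulli_fib_poly_generating_function\<close> below.\<close>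
definition bernoulli_fib_poly :: "nat \<Rightarrow> real \<Rightarrow> real" where
  "bernoulli_fib_poly n x =
     real (fib_fact n) * fps_nth (fps_X * golden_exp x / (golden_exp 1 - 1)) n"

definition bernoulli_fib :: "nat \<Rightarrow> real" where
  "bernoulli_fib n = bernoulli_fib_poly n 0"

lemma fib_fact_pos: "fib_fact n > 0"
  unfolding fib_fact_def by (rule prod_pos) (auto intro: fib_neq_0_nat)

lemma subdegree_golden_exp_minus_1: "subdegree (golden_exp 1 - 1) = 1"
  by (rule subdegreeI) (auto simp: golden_exp_def fib_fact_def)

lemma bernoulli_fib_poly_generating_function:
  "Abs_fps (\<lambda>n. bernoulli_fib_poly n x / real (fib_fact n)) =
     fps_X * golden_exp x / (golden_exp 1 - 1)"
  "Abs_fps (\<lambda>n. bernoulli_fib_poly n x / real (fib_fact n)) * (golden_exp 1 - 1) =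
     fps_X * golden_exp x"
proof -
  show 1: "Abs_fps (\<lambda>n. bernoulli_fib_poly n x / real (fib_fact n)) =
     fps_X * golden_exp x / (golden_exp 1 - 1)"
    using fib_fact_pos by (auto simp: fps_eq_iff bernoulli_fib_poly_def less_imp_neq)
  have "golden_exp x \<noteq> 0"
    by (auto simp: golden_exp_def fib_fact_def fps_eq_iff intro!: exI[of _ 0])
  moreover have "golden_exp 1 - 1 \<noteq> 0"
    using subdegree_golden_exp_minus_1 by fastforce
  ultimately have "golden_exp 1 - 1 dvd fps_X * golden_exp x"
    using subdegree_golden_exp_minus_1 by (subst fps_dvd_iff) (auto simp del: subdegree_minus_commute)
  then show "Abs_fps (\<lambda>n. bernoulli_fib_poly n x / real (fib_fact n)) * (golden_exp 1 - 1) =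
     fps_X * golden_exp x"
    unfolding 1 by simp
qed

lemma bernoulli_fib_generating_function:
  "Abs_fps (\<lambda>n. bernoulli_fib n / real (fib_fact n)) = fps_X / (golden_exp 1 - 1)"
proof -
  have "golden_exp 0 = 1"
    by (auto simp: golden_exp_def fps_eq_iff fib_fact_def)
  then show ?thesis
    using bernoulli_fib_poly_generating_function(1)[of 0] by (simp add: bernoulli_fib_def)
qed

text \<open>In particular, \<open>bernoulli_fib_poly n\<close> is a polynomial function.\<close>
lemma bernoulli_fib_poly_explicit:
  "bernoulli_fib_poly n x = (\<Sum>k=0..n. fibonomial n k * bernoulli_fib (n - k) * x ^ k)"
proof -
  let ?D = "golden_exp 1 - 1"
  have D: "?D \<noteq> 0"
    using subdegree_golden_exp_minus_1 by fastforce
  have "?D dvd fps_X"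
    using D subdegree_golden_exp_minus_1
    by (subst fps_dvd_iff) (auto simp del: subdegree_minus_commute)
  then have "fps_X * golden_exp x / ?D = golden_exp x * (fps_X / ?D)"
    by (simp add: div_mult_swap mult.commute)
  also have "\<dots> = golden_exp x * Abs_fps (\<lambda>n. bernoulli_fib n / real (fib_fact n))"
    by (simp add: bernoulli_fib_generating_function)
  finally have "bernoulli_fib_poly n x = real (fib_fact n) *
      (\<Sum>k=0..n. x ^ k / real (fib_fact k) * (bernoulli_fib (n - k) / real (fib_fact (n - k))))"
    by (simp add: bernoulli_fib_poly_def fps_mult_nth golden_exp_def)
  then show ?thesis
    by (simp add: sum_distrib_left fibonomial_def mult_ac)
qed

end

theory Submission
  imports Defs
begin

text \<open>Clearing the denominator in the generating function at \<open>x = 0\<close> gives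
  \<open>(\<Sum>j. b\<^sub>j z\<^sup>j / F\<^sub>j!) * (e\<^sub>F\<^sup>z - 1) = z\<close>. The claimed sum is \<open>F\<^sub>n!\<close> times the coefficient of
  \<open>z\<^sup>n\<close> on the left: subtracting 1 removes the constant term of the golden exponential,
  so the Cauchy product has no term \<open>j = n\<close>. On the right that coefficient is 0 for \<open>n \<ge> 2\<close>.\<close>

theorem corollary4p0p8:
  fixes n :: nat
  assumes "n \<ge> 2"
  shows "(\<Sum>j=0..n-1. fibonomial n j * bernoulli_fib j) = 0"
proof -
  obtain m where n: "n = Suc m" and m: "m > 0"
    using assms by (cases n) auto
  let ?b = "\<lambda>j. bernoulli_fib j / real (fib_fact j)"
  have const: "fps_nth (golden_exp 1 - 1) 0 = 0"
    by (simp add: golden_exp_def fib_fact_def)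
  have "0 = fps_nth (fps_X * golden_exp 0) n"
    using m by (simp add: n golden_exp_def)
  also have "\<dots> = fps_nth (Abs_fps ?b * (golden_exp 1 - 1)) n"
    using bernoulli_fib_poly_generating_function(2)[of 0] by (simp add: bernoulli_fib_def)
  also have "\<dots> = (\<Sum>j=0..n. ?b j * fps_nth (golden_exp 1 - 1) (n - j))"
    by (simp add: fps_mult_nth)
  also have "\<dots> = (\<Sum>j=0..m. ?b j * fps_nth (golden_exp 1 - 1) (n - j))"
    using const by (simp add: n)
  also have "\<dots> = (\<Sum>j=0..m. ?b j * (1 / real (fib_fact (n - j))))"
    by (rule sum.cong) (auto simp: n golden_exp_def)
  finally have "real (fib_fact n) * (\<Sum>j=0..m. ?b j * (1 / real (fib_fact (n - j)))) = 0"
    by simp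
  then show ?thesis
    by (simp add: n fibonomial_def sum_distrib_left mult_ac del: mult_eq_0_iff)
qed

end
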